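(* Let $n$ and $t$ be positive integers and let $m_1\geq m_2\geq \cdots\geq m_t\geq 2$ be integers. Then $$\hat{r}\Big(K_{1,n}, \bigsqcup_{j=1}^{t}K_{1, m_j}\Big) = \sum_{j=1}^{t}(n+m_j-1).$$ Moreover, if $F\rightarrow\big(K_{1,n},\bigsqcup_{j=1}^{t}K_{1, m_j}\big)$ and $e(F)=\sum_{j=1}^{t} (n+m_j-1)$, then $F=\bigsqcup_{j=1}^{t}G_j$, where for each $j$, either $G_j=K_{1,n+m_j-1}$, or $n=m_j=2$ and $G_j=K_3$.
   Context: All graphs are undirected, simple, finite and without isolated vertices. Equality of graphs means isomorphism. $e(F)$ denotes the number of edges of $F$. $K_{1,n}$ is the star with one root vertex joined to $n$ leaves, and $K_3$ is the triangle. $\sqcup$ denotes disjoint union of graphs. For graphs $F_1,F_2,G$, write $G\rightarrow(F_1,F_2)$ if for every coloring of the edges of $G$ by red and blue there is either a red copy of $F_1$ or a blue copy of $F_2$ in $G$ (copies are subgraphs, not necessarily induced). The size Ramsey number $\hat{r}(F_1,F_2)$ is the minimum number of edges of a graph $G$ such that $G\rightarrow(F_1,F_2)$. *)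

theory Defs
  imports Main
begin

record 'a graph =
  verts :: "'a set"
  edges :: "'a set set"

text \<open>The condition \<open>verts G = \<Union> (edges G)\<close> says both that edges join vertices
  of the graph and that there are no isolated vertices.\<close>

definition simple_graph :: "'a graph \<Rightarrow> bool" where
  "simple_graph G \<longleftrightarrow>
     finite (verts G) \<and> (\<forall>e\<in>edges G. card e = 2) \<and> verts G = \<Union> (edges G)"

definition graph_iso :: "'a graph \<Rightarrow> 'b graph \<Rightarrow> bool"  (infix \<open>\<cong>\<^sub>G\<close> 50) where
  "G \<cong>\<^sub>G H \<longleftrightarrow> (\<exists>f. bij_betw f (verts G) (verts H) \<and>
     (\<forall>u\<in>verts G. \<forall>v\<in>verts G. {u, v} \<in> edges G \<longleftrightarrow> {f u, f v} \<in> edges H))"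

definition subgraph :: "'a graph \<Rightarrow> 'a graph \<Rightarrow> bool" where
  "subgraph H G \<longleftrightarrow> simple_graph H \<and> verts H \<subseteq> verts G \<and> edges H \<subseteq> edges G"

definition star :: "nat \<Rightarrow> nat graph" where
  "star n = \<lparr>verts = {0..n}, edges = {{0, i} | i. i \<in> {1..n}}\<rparr>"

definition complete_graph :: "nat \<Rightarrow> nat graph" where
  "complete_graph n = \<lparr>verts = {..<n}, edges = {e. e \<subseteq> {..<n} \<and> card e = 2}\<rparr>"

definition disjoint_union :: "'i set \<Rightarrow> ('i \<Rightarrow> 'a graph) \<Rightarrow> ('i \<times> 'a) graph" where
  "disjoint_union I G =
     \<lparr>verts = (SIGMA i:I. verts (G i)), edges = (\<Union>i\<in>I. (\<lambda>e. Pair i ` e) ` edges (G i))\<rparr>"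

datatype colour = Red | Blue

text \<open>A colouring is a total function on vertex sets; only its values on edges matter.\<close>

definition mono_copy :: "'a graph \<Rightarrow> ('a set \<Rightarrow> colour) \<Rightarrow> colour \<Rightarrow> 'b graph \<Rightarrow> bool" where
  "mono_copy G c k F \<longleftrightarrow> (\<exists>H. subgraph H G \<and> H \<cong>\<^sub>G F \<and> (\<forall>e\<in>edges H. c e = k))"

definition arrows :: "'a graph \<Rightarrow> 'b graph \<Rightarrow> 'c graph \<Rightarrow> bool" where
  "arrows G F1 F2 \<longleftrightarrow> (\<forall>c. mono_copy G c Red F1 \<or> mono_copy G c Blue F2)"

text \<open>Every finite graph is isomorphic to one with vertices in \<^typ>\<open>nat\<close>, so it suffices to let
  the host graph range over these.  Since \<open>Inf {} = 0\<close> on \<^typ>\<open>nat\<close>, a positive value is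
  always an attained minimum.\<close>

definition size_ramsey :: "'a graph \<Rightarrow> 'b graph \<Rightarrow> nat" where
  "size_ramsey F1 F2 =
     Inf {card (edges G) | G :: nat graph. simple_graph G \<and> arrows G F1 F2}"

lemma simple_graph_star: "n \<ge> 1 \<Longrightarrow> simple_graph (star n)"
proof -
  assume n: "n \<ge> 1"
  have "{0..n} = \<Union> {{0, i} | i. i \<in> {1..n}}"
  proof (intro set_eqI iffI)
    fix x assume "x \<in> {0..n}"
    then have "x \<in> {0, if x = 0 then 1 else x}" "(if x = 0 then 1 else x) \<in> {1..n}"
      using n by auto
    then show "x \<in> \<Union> {{0, i} | i. i \<in> {1..n}}" by blast
  qed (use n in auto)
  thus ?thesis by (auto simp: simple_graph_def star_def)
qed

lemma card_edges_star: "card (edges (star n)) = n"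
proof -
  have "edges (star n) = (\<lambda>i. {0, i}) ` {1..n}" by (auto simp: star_def)
  moreover have "inj_on (\<lambda>i::nat. {0, i}) {1..n}" by (auto simp: inj_on_def doubleton_eq_iff)
  ultimately show ?thesis by (simp add: card_image)
qed

lemma simple_graph_complete_graph: "n \<ge> 2 \<Longrightarrow> simple_graph (complete_graph n)"
proof -
  assume n: "n \<ge> 2"
  have "\<exists>e. e \<subseteq> {..<n} \<and> card e = 2 \<and> x \<in> e" if "x < n" for x
    using that n by (intro exI[of _ "{x, if x = 0 then 1 else 0}"]) auto
  thus ?thesis by (auto simp: simple_graph_def complete_graph_def)
qed

lemma simple_graph_disjoint_union:
  assumes "finite I" "\<And>i. i \<in> I \<Longrightarrow> simple_graph (G i)"
  shows "simple_graph (disjoint_union I G)"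
proof -
  have 1: "card (Pair i ` e) = card e" for i :: 'a and e :: "'b set"
    by (simp add: card_image inj_on_def)
  have 2: "verts (G i) = \<Union> (edges (G i))" "finite (verts (G i))"
    "\<And>e. e \<in> edges (G i) \<Longrightarrow> card e = 2" if "i \<in> I" for i
    using assms(2)[OF that] unfolding simple_graph_def by blast+
  have "(SIGMA i:I. verts (G i)) = \<Union> (\<Union>i\<in>I. (\<lambda>e. Pair i ` e) ` edges (G i))"
    using 2(1) by (simp add: image_Union set_eq_iff) blast
  moreover have "finite (SIGMA i:I. verts (G i))"
    using assms(1) 2(2) by (rule finite_SigmaI)
  ultimately show ?thesis
    using 1 2(3) by (auto simp: simple_graph_def disjoint_union_def)
qed

end

theory Submission
  imports Defs "HOL-Library.Disjoint_Sets" "HOL-Library.Nat_Bijection"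
begin

text \<open>
  Write \<open>S\<close> for the star forest with parts \<open>K\<^bsub>1,m j\<^esub>\<close>, \<open>j\<close> ranging over a set \<open>I\<close> of \<open>t\<close>
  indices. The proof is an induction on \<open>n\<close> that removes one matching at a time.

  If \<open>F\<close> arrows \<open>(K\<^bsub>1,n+1\<^esub>, S)\<close> and \<open>M\<close> is a matching of \<open>F\<close>, then \<open>F - M\<close> arrows
  \<open>(K\<^bsub>1,n\<^esub>, S)\<close>, because colouring \<open>M\<close> red raises every red degree by at most one
  (\<open>forces_minus_matching\<close>). Colouring all edges blue shows that \<open>F\<close> contains \<open>S\<close>, hence a
  matching with \<open>t\<close> edges, so the lower bound grows by \<open>t\<close> in each step. For \<open>n = 1\<close> no edge
  can be red and \<open>F\<close> just has to contain \<open>S\<close>.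

  If \<open>F\<close> attains the bound for \<open>n + 1\<close>, then it has no matching with more than \<open>t\<close> edges,
  and \<open>F - M\<close> attains the bound for \<open>n\<close> for every matching \<open>M\<close> with \<open>t\<close> edges; by induction
  each such \<open>F - M\<close> is a disjoint union of \<open>t\<close> stars and triangles. Fix one \<open>M\<close>.
  An edge of \<open>M\<close> cannot join two components of \<open>F - M\<close>: removing from \<open>F\<close> a suitable
  edge of each component, instead of \<open>M\<close>, would leave a path with three edges,
  and neither a star nor a triangle contains one. By the bound on
  matchings, an edge of \<open>M\<close> must meet every edge of some component. So it either attaches a new
  leaf to the centre of a star, or joins the two leaves of a star \<open>K\<^bsub>1,2\<^esub>\<close>. No star receives two
  edges of \<open>M\<close>, so each of the \<open>t\<close> components is a star that receives exactly one
  (\<open>extremal_parts_step\<close>).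

  The bound is attained by the disjoint union of the stars \<open>K\<^bsub>1,n+m j-1\<^esub>\<close>: if a colouring
  of it has no red \<open>K\<^bsub>1,n\<^esub>\<close>, then the \<open>j\<close>-th star has at least \<open>m j\<close> blue edges.

  The combinatorics is carried out on sets of edges and translated to graphs at the end.
\<close>

section \<open>Star forests as sets of edges\<close>

text \<open>The edge set of a star with \<open>s\<close> leaves; for \<open>s = 0\<close> it is empty.\<close>

definition is_star :: "nat \<Rightarrow> 'a set set \<Rightarrow> bool" where
  "is_star s A \<longleftrightarrow> (\<exists>c L. finite L \<and> card L = s \<and> c \<notin> L \<and> A = (\<lambda>l. {c, l}) ` L)"

text \<open>The edge set of a triangle.\<close>

definition is_triangle :: "'a set set \<Rightarrow> bool" where
  "is_triangle A \<longleftrightarrow>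
     (\<exists>x y z. x \<noteq> y \<and> y \<noteq> z \<and> x \<noteq> z \<and> A = {{x, y}, {y, z}, {x, z}})"

text \<open>The edge set \<open>B\<close> contains vertex-disjoint stars with \<open>m j\<close> leaves, one for each \<open>j\<close>
  in \<open>I\<close>; if every \<open>m j\<close> is positive, this is a copy of the star forest.\<close>

definition has_forest :: "'i set \<Rightarrow> ('i \<Rightarrow> nat) \<Rightarrow> 'a set set \<Rightarrow> bool" where
  "has_forest I m B \<longleftrightarrow> (\<exists>Q. disjoint_family_on (\<lambda>j. \<Union> (Q j)) I \<and>
     (\<forall>j\<in>I. is_star (m j) (Q j) \<and> Q j \<subseteq> B))"

text \<open>The arrow relation \<open>E \<rightarrow> (K\<^bsub>1,n\<^esub>, S)\<close> on edge sets. A colouring is given by its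
  set \<open>R\<close> of red edges; there is no red \<open>K\<^bsub>1,n\<^esub>\<close> exactly when all red degrees are below \<open>n\<close>.\<close>

definition forces :: "nat \<Rightarrow> 'i set \<Rightarrow> ('i \<Rightarrow> nat) \<Rightarrow> 'a set set \<Rightarrow> bool" where
  "forces n I m E \<longleftrightarrow>
     (\<forall>R\<subseteq>E. (\<forall>v. card {e \<in> R. v \<in> e} < n) \<longrightarrow> has_forest I m (E - R))"

text \<open>The family \<open>P\<close> consists of the components of an extremal graph for \<open>n\<close> and \<open>m\<close>,
  as edge sets.\<close>

definition extremal_parts ::
    "nat \<Rightarrow> 'i set \<Rightarrow> ('i \<Rightarrow> nat) \<Rightarrow> ('i \<Rightarrow> 'a set set) \<Rightarrow> bool" where
  "extremal_parts n I m P \<longleftrightarrow> disjoint_family_on (\<lambda>j. \<Union> (P j)) I \<and>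
     (\<forall>j\<in>I. is_star (n + m j - 1) (P j) \<or> n = 2 \<and> m j = 2 \<and> is_triangle (P j))"

lemma card_star_edges:
  assumes "finite L" "c \<notin> L"
  shows "card ((\<lambda>l. {c, l}) ` L) = card L"
  using assms by (intro card_image) (auto simp: inj_on_def doubleton_eq_iff)

lemma is_star_card: "is_star s A \<Longrightarrow> card A = s"
  unfolding is_star_def using card_star_edges by metis

lemma is_star_finite: "is_star s A \<Longrightarrow> finite A"
  unfolding is_star_def by auto

lemma card_edge_is_star: "is_star s A \<Longrightarrow> e \<in> A \<Longrightarrow> card e = 2"
  unfolding is_star_def by (auto simp: card_insert_if)

lemma disjoint_family_edges:
  assumes "disjoint_family_on (\<lambda>j. \<Union> (P j)) I" "{} \<notin> \<Union> (P ` I)"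
  shows "disjoint_family_on P I"
  unfolding disjoint_family_on_def
proof (intro ballI impI)
  fix i j assume ij: "i \<in> I" "j \<in> I" "i \<noteq> j"
  hence dj: "\<Union> (P i) \<inter> \<Union> (P j) = {}"
    using assms(1) by (simp add: disjoint_family_on_def)
  have "e = {}" if "e \<in> P i" "e \<in> P j" for e using dj that by blast
  with assms(2) ij show "P i \<inter> P j = {}" by blast
qed

lemma card_UN_stars:
  assumes "finite I" "disjoint_family_on (\<lambda>j. \<Union> (Q j)) I" "\<And>j. j \<in> I \<Longrightarrow> is_star (s j) (Q j)"
  shows "card (\<Union>j\<in>I. Q j) = (\<Sum>j\<in>I. s j)"
proof -
  have "{} \<notin> \<Union> (Q ` I)"
    using card_edge_is_star[OF assms(3)] by force
  with assms(2) have "disjoint_family_on Q I" by (rule disjoint_family_edges)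
  hence "card (\<Union>j\<in>I. Q j) = (\<Sum>j\<in>I. card (Q j))"
    using assms(1) is_star_finite[OF assms(3)]
    by (intro card_UN_disjoint) (auto simp: disjoint_family_on_def)
  also have "\<dots> = (\<Sum>j\<in>I. s j)"
    using assms(3) is_star_card by (intro sum.cong) blast+
  finally show ?thesis .
qed

section \<open>Removing a matching\<close>

lemma forces_minus_matching:
  assumes "forces (Suc n) I m E" "M \<subseteq> E" "disjoint M" "finite E"
  shows "forces n I m (E - M)"
  unfolding forces_def
proof (intro allI impI)
  fix R assume R: "R \<subseteq> E - M" "\<forall>v. card {e \<in> R. v \<in> e} < n"
  have fin: "finite R" "finite M" using R(1) assms(2,4) by (auto intro: finite_subset)
  have "card {e \<in> R \<union> M. v \<in> e} < Suc n" for v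
  proof -
    have "card {e \<in> M. v \<in> e} \<le> 1"
      using assms(3) fin by (auto simp: card_le_Suc0_iff_eq disjoint_def)
    moreover have "{e \<in> R \<union> M. v \<in> e} = {e \<in> R. v \<in> e} \<union> {e \<in> M. v \<in> e}" by auto
    ultimately show ?thesis
      using R(2)[rule_format, of v] card_Un_le[of "{e \<in> R. v \<in> e}" "{e \<in> M. v \<in> e}"] by simp
  qed
  moreover have "R \<union> M \<subseteq> E" using R assms by auto
  ultimately have "has_forest I m (E - (R \<union> M))"
    using assms(1) unfolding forces_def by blast
  moreover have "E - (R \<union> M) = E - M - R" by auto
  ultimately show "has_forest I m (E - M - R)" by simp
qed

lemma forces_has_forest: "forces n I m E \<Longrightarrow> n \<ge> 1 \<Longrightarrow> has_forest I m E"
  \<comment> \<open>Colour every edge blue.\<close>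
  unfolding forces_def by (drule spec[of _ "{}"]) simp

text \<open>In a graph, \<open>disjoint\<close> sets of edges are matchings.\<close>

lemma matching_of_representatives:
  assumes "disjoint_family_on (\<lambda>j. \<Union> (P j)) I"
    and "\<And>j. j \<in> I \<Longrightarrow> g j \<in> P j" "\<And>j. j \<in> I \<Longrightarrow> g j \<noteq> {}"
  shows "disjoint (g ` I)" "card (g ` I) = card I"
proof -
  have *: "g i \<inter> g j = {}" if "i \<in> I" "j \<in> I" "i \<noteq> j" for i j
    using assms(1,2) that unfolding disjoint_family_on_def by blast
  show "disjoint (g ` I)" using * by (auto simp: disjoint_def)
  have "inj_on g I" using * assms(3) by (metis inf.idem inj_onI)
  thus "card (g ` I) = card I" by (rule card_image)
qed

lemma has_forest_matching:
  assumes "has_forest I m E" "\<And>j. j \<in> I \<Longrightarrow> m j \<ge> 1"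
  obtains M where "M \<subseteq> E" "disjoint M" "card M = card I"
proof -
  obtain Q where Q: "disjoint_family_on (\<lambda>j. \<Union> (Q j)) I"
    "\<And>j. j \<in> I \<Longrightarrow> is_star (m j) (Q j)" "\<And>j. j \<in> I \<Longrightarrow> Q j \<subseteq> E"
    using assms(1) unfolding has_forest_def by blast
  have "\<exists>e. e \<in> Q j" if "j \<in> I" for j
    using is_star_card[OF Q(2)[OF that]] assms(2)[OF that] by (cases "Q j = {}") auto
  then obtain g where g: "\<And>j. j \<in> I \<Longrightarrow> g j \<in> Q j" by metis
  have "g j \<noteq> {}" if "j \<in> I" for j
    using card_edge_is_star[OF Q(2)[OF that] g[OF that]] by auto
  from matching_of_representatives[OF Q(1) g this] g Q(3)
  show ?thesis by (intro that[of "g ` I"]) auto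
qed

section \<open>The structure of extremal graphs\<close>

lemma extremal_parts_edge:
  assumes "extremal_parts n I m P" "j \<in> I" "e \<in> P j"
  shows "card e = 2"
  using assms card_edge_is_star unfolding extremal_parts_def is_triangle_def
  by (fastforce simp: card_insert_if)

lemma extremal_parts_two_edges:
  assumes "extremal_parts n I m P" "j \<in> I" "n \<ge> 1" "m j \<ge> 2"
  shows "\<exists>g \<in> P j. g \<noteq> e"
proof -
  have "card (P j) \<ge> 2"
    using assms is_star_card unfolding extremal_parts_def is_triangle_def
    by (fastforce simp: card_insert_if doubleton_eq_iff)
  hence "\<not> P j \<subseteq> {e}" by (auto dest: card_mono[rotated])
  thus ?thesis by blast
qed

lemma extremal_parts_no_path:
  assumes P: "extremal_parts n I m P"
    and e: "{a, b} \<in> (\<Union>j\<in>I. P j)" "{b, c} \<in> (\<Union>j\<in>I. P j)" "{c, d} \<in> (\<Union>j\<in>I. P j)"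
    and d: "distinct [a, b, c, d]"
  shows False
proof -
  have disj: "i = j" if "i \<in> I" "j \<in> I" "v \<in> \<Union> (P i)" "v \<in> \<Union> (P j)" for i j v
    using P that unfolding extremal_parts_def disjoint_family_on_def by blast
  obtain j where j: "j \<in> I" "{b, c} \<in> P j" using e(2) by blast
  have ab: "{a, b} \<in> P j" using e(1) j disj[of _ j b] by blast
  have cd: "{c, d} \<in> P j" using e(3) j disj[of _ j c] by blast
  have "is_star (n + m j - 1) (P j) \<or> is_triangle (P j)"
    using P j unfolding extremal_parts_def by blast
  thus False
  proof
    assume "is_star (n + m j - 1) (P j)"
    then obtain x L where "P j = (\<lambda>l. {x, l}) ` L" unfolding is_star_def by blast
    hence "x \<in> e" if "e \<in> P j" for e using that by auto
    from this[OF ab] this[OF j(2)] this[OF cd] have "x \<in> {a, b}" "x \<in> {b, c}" "x \<in> {c, d}" .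
    thus False using d by auto
  next
    assume "is_triangle (P j)"
    then obtain x y z where xyz: "P j = {{x, y}, {y, z}, {x, z}}"
      unfolding is_triangle_def by blast
    have "{a, b, c, d} \<subseteq> {x, y, z}" using ab cd unfolding xyz by blast
    hence "card {a, b, c, d} \<le> card {x, y, z}" by (intro card_mono) auto
    thus False using d by (auto simp: card_insert_if split: if_splits)
  qed
qed

text \<open>Let \<open>t\<close> bound the size of the matchings of \<open>E\<close>. A matching \<open>N\<close> can be enlarged by one
  edge from each part that has an edge avoiding \<open>N\<close>, so only few parts have one.\<close>

lemma matching_extension:
  assumes disj: "disjoint_family_on (\<lambda>j. \<Union> (P j)) I" and fin: "finite I"
    and sub: "\<And>j. j \<in> I \<Longrightarrow> P j \<subseteq> E"
    and max: "\<And>N. N \<subseteq> E \<Longrightarrow> disjoint N \<Longrightarrow> card N \<le> t"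
    and N: "N \<subseteq> E" "disjoint N" "finite N" and J: "J \<subseteq> I"
    and av: "\<And>j. j \<in> J \<Longrightarrow> \<exists>f\<in>P j. f \<noteq> {} \<and> f \<inter> \<Union> N = {}"
  shows "card N + card J \<le> t"
proof -
  obtain f where f: "\<And>j. j \<in> J \<Longrightarrow> f j \<in> P j \<and> f j \<noteq> {} \<and> f j \<inter> \<Union> N = {}"
    using av by metis
  have disj': "disjoint_family_on (\<lambda>j. \<Union> (P j)) J"
    using disj J unfolding disjoint_family_on_def by blast
  have fJ: "disjoint (f ` J)" "card (f ` J) = card J"
    using matching_of_representatives[OF disj', of f] f by auto
  have sep: "g \<inter> h = {}" if "g \<in> N" "h \<in> f ` J" for g h using that f by fastforce
  have "disjoint (N \<union> f ` J)"
    by (rule disjoint_union[OF N(2) fJ(1)]) (use f in fastforce)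
  moreover have "N \<inter> f ` J = {}" using sep f by fastforce
  hence "card (N \<union> f ` J) = card N + card J"
    using fJ(2) N(3) finite_subset[OF J fin] by (subst card_Un_disjoint) auto
  moreover have "N \<union> f ` J \<subseteq> E" using N(1) f sub J by blast
  ultimately show ?thesis using max by metis
qed

text \<open>If every matching of \<open>E\<close> has at most \<open>t = card I\<close> edges, and removing any matching with
  \<open>t\<close> edges leaves extremal components for \<open>n\<close>, then \<open>E\<close> has extremal
  components for \<open>n + 1\<close>.\<close>

lemma extremal_parts_step:
  fixes E :: "'a set set" and I :: "'i set"
  assumes fin: "finite I" and n: "n \<ge> 1" and m: "\<And>j. j \<in> I \<Longrightarrow> m j \<ge> 2"
    and E2: "\<And>e. e \<in> E \<Longrightarrow> card e = 2"
    and max: "\<And>N. N \<subseteq> E \<Longrightarrow> disjoint N \<Longrightarrow> card N \<le> card I"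
    and ext: "\<And>N. N \<subseteq> E \<Longrightarrow> disjoint N \<Longrightarrow> card N = card I \<Longrightarrow>
                \<exists>P. extremal_parts n I m P \<and> E - N = (\<Union>j\<in>I. P j)"
    and M: "M \<subseteq> E" "disjoint M" "card M = card I" "finite M"
  shows "\<exists>Q. extremal_parts (Suc n) I m Q \<and> E = (\<Union>j\<in>I. Q j)"
proof -
  obtain P where P: "extremal_parts n I m P" and EM: "E - M = (\<Union>j\<in>I. P j)"
    using ext[OF M(1-3)] by blast
  have disj: "disjoint_family_on (\<lambda>j. \<Union> (P j)) I"
    using P unfolding extremal_parts_def by blast
  have same: "i = j" if "i \<in> I" "j \<in> I" "v \<in> \<Union> (P i)" "v \<in> \<Union> (P j)" for i j v
    using disj that unfolding disjoint_family_on_def by blast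
  have PE: "P j \<subseteq> E" "P j \<inter> M = {}" if "j \<in> I" for j using EM that by blast+
  note P2 = extremal_parts_edge[OF P]
  have two: "\<exists>g \<in> P j. g \<noteq> e" if "j \<in> I" for j e
    using extremal_parts_two_edges[OF P that n m[OF that]] .
  note extend = matching_extension[OF disj fin PE(1) max]

  \<comment> \<open>Otherwise pick an edge \<open>{u, u'}\<close> of \<open>P i\<close> and an edge \<open>{v, v'}\<close> of \<open>P j\<close>, and remove
      from \<open>E\<close> one edge of each component, different from these two. The path \<open>u' u v v'\<close>
      survives.\<close>
  have no_link: "i = j" if uv: "{u, v} \<in> M" and i: "i \<in> I" "u \<in> \<Union> (P i)"
      and j: "j \<in> I" "v \<in> \<Union> (P j)" for u v i j
  proof (rule ccontr)
    assume "i \<noteq> j"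
    have other: "\<exists>y. {x, y} \<in> P k \<and> y \<noteq> x" if k: "k \<in> I" "x \<in> \<Union> (P k)" for x k
    proof -
      obtain e where "e \<in> P k" "x \<in> e" using k(2) by (rule UnionE)
      moreover then obtain y where "e = {x, y}" "x \<noteq> y"
        using P2[OF k(1)] by (auto simp: card_2_iff)
      ultimately show ?thesis by blast
    qed
    obtain u' where u': "{u, u'} \<in> P i" "u' \<noteq> u" using other[OF i] by blast
    obtain v' where v': "{v, v'} \<in> P j" "v' \<noteq> v" using other[OF j] by blast
    have "\<exists>g \<in> P k. g \<noteq> {u, u'} \<and> g \<noteq> {v, v'}" if "k \<in> I" for k
    proof -
      have "\<not> ({u, u'} \<in> P k \<and> {v, v'} \<in> P k)"
        using \<open>i \<noteq> j\<close> same[of i k u] same[of j k v] that i j by blast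
      thus ?thesis using two[OF that, of "{u, u'}"] two[OF that, of "{v, v'}"] by metis
    qed
    then obtain g where g: "\<And>k. k \<in> I \<Longrightarrow> g k \<in> P k \<and> g k \<noteq> {u, u'} \<and> g k \<noteq> {v, v'}"
      by metis
    have ne: "g k \<noteq> {}" if "k \<in> I" for k using P2[OF that] g[OF that] by fastforce
    have "disjoint (g ` I)" "card (g ` I) = card I"
      using matching_of_representatives[OF disj, of g] g ne by blast+
    moreover have "g ` I \<subseteq> E" using g PE(1) by blast
    ultimately have "\<exists>P'. extremal_parts n I m P' \<and> E - g ` I = (\<Union>j\<in>I. P' j)"
      by (intro ext)
    then obtain P' where P': "extremal_parts n I m P'" "E - g ` I = (\<Union>j\<in>I. P' j)"
      by blast
    have "{u, u'} \<notin> g ` I" "{v, v'} \<notin> g ` I" using g by blast+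
    moreover have "{u, u'} \<in> E" "{v, v'} \<in> E"
      using PE(1)[OF i(1)] PE(1)[OF j(1)] u'(1) v'(1) by blast+
    moreover have "{u, v} \<in> E" using uv M(1) by blast
    moreover have "{u, v} \<notin> g ` I"
    proof
      assume "{u, v} \<in> g ` I"
      then obtain k where k: "k \<in> I" "{u, v} = g k" by (rule imageE)
      with g[OF k(1)] have "{u, v} \<in> P k" by simp
      with PE(2)[OF k(1)] uv show False by blast
    qed
    ultimately have "{u', u} \<in> E - g ` I" "{v, v'} \<in> E - g ` I" "{u, v} \<in> E - g ` I"
      by (simp_all add: insert_commute)
    moreover have "distinct [u', u, v, v']"
    proof -
      have "u' \<in> \<Union> (P i)" "v' \<in> \<Union> (P j)" using u' v' by blast+
      thus ?thesis using u'(2) v'(2) same[OF i(1) j(1)] i(2) j(2) \<open>i \<noteq> j\<close> by auto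
    qed
    ultimately show False using extremal_parts_no_path[OF P'(1)] unfolding P'(2) by blast
  qed

  \<comment> \<open>Adding \<open>e\<close> to the star \<open>P j\<close> creates a new leaf or closes \<open>K\<^bsub>1,2\<^esub>\<close> to a triangle.\<close>
  define att where "att j e \<longleftrightarrow> (\<exists>c L. finite L \<and> c \<notin> L \<and> card L = n + m j - 1 \<and>
      P j = (\<lambda>l. {c, l}) ` L \<and>
      ((\<exists>w. e = {c, w} \<and> (\<forall>k\<in>I. w \<notin> \<Union> (P k))) \<or> (e = L \<and> card L = 2)))" for j e

  \<comment> \<open>If every component had an edge avoiding \<open>e\<close>, these edges and \<open>e\<close> would form a matching
      with \<open>t + 1\<close> edges.\<close>
  have attached: "\<exists>j\<in>I. att j e" if e: "e \<in> M" for e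
  proof -
    have ce: "card e = 2" using E2 e M(1) by blast
    hence fe: "finite e" by (intro card_ge_0_finite) simp
    have "\<exists>j\<in>I. \<forall>f\<in>P j. f \<inter> e \<noteq> {}"
    proof (rule ccontr)
      assume "\<not> ?thesis"
      hence free: "\<exists>f\<in>P j. f \<inter> e = {}" if "j \<in> I" for j using that by blast
      have "\<exists>f\<in>P j. f \<noteq> {} \<and> f \<inter> \<Union> {e} = {}" if j: "j \<in> I" for j
      proof -
        obtain f where f: "f \<in> P j" "f \<inter> e = {}" using free[OF j] by blast
        with P2[OF j f(1)] have "f \<noteq> {}" by auto
        with f show ?thesis by auto
      qed
      hence "card {e} + card I \<le> card I"
        by (intro extend) (use e M(1) in \<open>auto simp: disjoint_def\<close>)
      thus False by simp
    qed
    then obtain j where j: "j \<in> I" and hit: "\<And>f. f \<in> P j \<Longrightarrow> f \<inter> e \<noteq> {}" by blast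
    have ePj: "e \<notin> P j" using PE(2)[OF j] e by blast
    \<comment> \<open>An edge outside a triangle contains at most one of its vertices, so it misses the
        opposite edge.\<close>
    have "\<not> is_triangle (P j)"
    proof
      assume "is_triangle (P j)"
      then obtain x y z where xyz: "x \<noteq> y" "y \<noteq> z" "x \<noteq> z" "P j = {{x, y}, {y, z}, {x, z}}"
        unfolding is_triangle_def by blast
      have "{x, y} \<inter> e \<noteq> {}" "{y, z} \<inter> e \<noteq> {}" "{x, z} \<inter> e \<noteq> {}"
        by (rule hit, simp add: xyz(4))+
      hence "x \<in> e \<and> y \<in> e \<or> y \<in> e \<and> z \<in> e \<or> x \<in> e \<and> z \<in> e" by blast
      moreover have "e = {a, b}" if "a \<in> e" "b \<in> e" "a \<noteq> b" for a b
        using that ce fe by (intro card_subset_eq[symmetric]) auto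
      ultimately have "e = {x, y} \<or> e = {y, z} \<or> e = {x, z}" using xyz(1-3) by metis
      thus False using ePj unfolding xyz(4) by blast
    qed
    then obtain c L where cL: "finite L" "card L = n + m j - 1" "c \<notin> L"
        "P j = (\<lambda>l. {c, l}) ` L"
      using P j unfolding extremal_parts_def is_star_def by blast
    have "card L \<ge> 2" using cL(2) n m[OF j] by simp
    have attI: "att j e"
      if "(\<exists>w. e = {c, w} \<and> (\<forall>k\<in>I. w \<notin> \<Union> (P k))) \<or> (e = L \<and> card L = 2)"
      unfolding att_def by (intro exI[of _ c] exI[of _ L] conjI cL that)
    have "att j e"
    proof (cases "c \<in> e")
      case True
      then obtain w where w: "e = {c, w}" "w \<noteq> c" using ce by (auto simp: card_2_iff)
      have "L \<noteq> {}" using \<open>card L \<ge> 2\<close> by auto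
      hence cV: "c \<in> \<Union> (P j)" unfolding cL(4) by auto
      have out: "w \<notin> \<Union> (P k)" if k: "k \<in> I" for k
      proof
        assume wk: "w \<in> \<Union> (P k)"
        with no_link[OF _ j cV k wk] e w(1) have "j = k" by simp
        with wk have "w \<in> \<Union> (P j)" by simp
        with w(2) have "w \<in> L" unfolding cL(4) by (auto split: if_splits)
        thus False using ePj w(1) unfolding cL(4) by blast
      qed
      have "(\<exists>w. e = {c, w} \<and> (\<forall>k\<in>I. w \<notin> \<Union> (P k))) \<or> (e = L \<and> card L = 2)"
        using w(1) out by blast
      thus ?thesis by (intro attI)
    next
      case False
      with hit have "L \<subseteq> e" unfolding cL(4) by auto
      hence "L = e" using \<open>card L \<ge> 2\<close> ce fe by (intro card_subset_eq) (auto dest: card_mono)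
      hence "(\<exists>w. e = {c, w} \<and> (\<forall>k\<in>I. w \<notin> \<Union> (P k))) \<or> (e = L \<and> card L = 2)"
        using ce by blast
      thus ?thesis by (intro attI)
    qed
    with j show ?thesis by blast
  qed

  have att_unique: "e = e'" if j: "j \<in> I" and a: "att j e" "att j e'"
      and e: "e \<in> M" "e' \<in> M" for j e e'
  proof (rule ccontr)
    assume ne: "e \<noteq> e'"
    hence dj: "e \<inter> e' = {}" using M(2) e by (auto simp: disjoint_def)
    \<comment> \<open>A new leaf and a chord at the same \<open>K\<^bsub>1,2\<^esub>\<close> would give two independent edges, which
        extend by one edge of each other component to a matching with \<open>t + 1\<close> edges.\<close>
    have cross: False if d: "f \<inter> f' = {}" and f: "f \<in> M" "f' \<in> M"
        and w: "f = {c, w}" "\<forall>k\<in>I. w \<notin> \<Union> (P k)"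
        and cL: "card L = 2" "P j = (\<lambda>l. {c, l}) ` L" "f' = L" for f f' c w L
    proof -
      have sub: "{f, f'} \<subseteq> E" using f M(1) by blast
      have L: "L \<noteq> {}" using cL(1) by auto
      hence "f \<noteq> f'" using d cL(3) by auto
      have Vj: "\<Union> {f, f'} \<subseteq> insert w (\<Union> (P j))"
        using L unfolding w(1) cL(2) cL(3) by auto
      have av: "\<exists>g\<in>P k. g \<noteq> {} \<and> g \<inter> \<Union> {f, f'} = {}" if k: "k \<in> I - {j}" for k
      proof -
        obtain g where g: "g \<in> P k" using two k by blast
        have "g \<noteq> {}" using P2[of k g] g k by auto
        moreover have "g \<inter> \<Union> {f, f'} = {}"
          using g Vj w(2) same[of k j] j k by blast
        ultimately show ?thesis using g by blast
      qed
      have "card {f, f'} + card (I - {j}) \<le> card I"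
        by (rule extend[OF _ _ _ sub _ _ _ av]) (use d in \<open>auto simp: disjoint_def\<close>)
      moreover have "card I > 0" using j fin card_gt_0_iff by blast
      ultimately show False using \<open>f \<noteq> f'\<close> j fin by simp
    qed
    obtain c L where cL: "finite L" "c \<notin> L" "card L = n + m j - 1" "P j = (\<lambda>l. {c, l}) ` L"
      and c1: "(\<exists>w. e = {c, w} \<and> (\<forall>k\<in>I. w \<notin> \<Union> (P k))) \<or> (e = L \<and> card L = 2)"
      using a(1) unfolding att_def by blast
    obtain c' L' where cL': "finite L'" "c' \<notin> L'" "card L' = n + m j - 1"
        "P j = (\<lambda>l. {c', l}) ` L'"
      and c2: "(\<exists>w. e' = {c', w} \<and> (\<forall>k\<in>I. w \<notin> \<Union> (P k))) \<or> (e' = L' \<and> card L' = 2)"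
      using a(2) unfolding att_def by blast
    have "card L \<ge> 2" using cL n m[OF j] by simp
    then obtain x y where xy: "x \<in> L" "y \<in> L" "x \<noteq> y"
      by (metis cL(1) card_le_Suc0_iff_eq not_less_eq_eq numeral_2_eq_2)
    have "{c, x} \<in> P j" "{c, y} \<in> P j" using xy cL(4) by auto
    hence "c' \<in> {c, x}" "c' \<in> {c, y}" unfolding cL'(4) by blast+
    \<comment> \<open>A star with at least two leaves determines its centre and its leaves.\<close>
    hence cc: "c' = c" using xy by auto
    have LL: "L' = L"
    proof -
      have "l \<in> L \<longleftrightarrow> {c, l} \<in> P j" for l
        using cL(2) unfolding cL(4) by (auto simp: doubleton_eq_iff)
      moreover have "l \<in> L' \<longleftrightarrow> {c, l} \<in> P j" for l
        using cL'(2) unfolding cL'(4) cc by (auto simp: doubleton_eq_iff)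
      ultimately show ?thesis by blast
    qed
    note c2' = c2[unfolded cc LL]
    from c1 show False
    proof
      assume 1: "\<exists>w. e = {c, w} \<and> (\<forall>k\<in>I. w \<notin> \<Union> (P k))"
      from c2' show False
      proof
        assume "\<exists>w. e' = {c, w} \<and> (\<forall>k\<in>I. w \<notin> \<Union> (P k))"
        with 1 dj show False by blast
      next
        assume "e' = L \<and> card L = 2"
        with 1 cross[OF dj e] cL(4) show False by blast
      qed
    next
      assume 1: "e = L \<and> card L = 2"
      from c2' show False
      proof
        assume "\<exists>w. e' = {c, w} \<and> (\<forall>k\<in>I. w \<notin> \<Union> (P k))"
        with 1 cross[of e' e] dj e cL(4) show False by blast
      next
        assume "e' = L \<and> card L = 2"
        with 1 ne show False by blast
      qed
    qed
  qed

  obtain \<phi> where \<phi>: "\<And>e. e \<in> M \<Longrightarrow> \<phi> e \<in> I \<and> att (\<phi> e) e" using attached by metis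
  have inj: "inj_on \<phi> M" using att_unique \<phi> by (metis inj_onI)
  have "\<phi> ` M = I"
    using \<phi> fin by (intro card_subset_eq) (auto simp: card_image[OF inj] M(3))
  with \<phi> have "\<exists>e\<in>M. att j e" if "j \<in> I" for j using that by blast
  then obtain \<psi> where \<psi>: "\<And>j. j \<in> I \<Longrightarrow> \<psi> j \<in> M \<and> att j (\<psi> j)" by metis
  have range_\<psi>: "\<psi> ` I = M"
  proof
    show "M \<subseteq> \<psi> ` I"
    proof
      fix e assume e: "e \<in> M"
      with \<phi> \<psi> att_unique[of "\<phi> e" e "\<psi> (\<phi> e)"] have "e = \<psi> (\<phi> e)" by blast
      thus "e \<in> \<psi> ` I" using \<phi>[OF e] by blast
    qed
  qed (use \<psi> in blast)
  hence inj\<psi>: "inj_on \<psi> I" using M(3) fin by (intro eq_card_imp_inj_on) auto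

  define Q where "Q j = insert (\<psi> j) (P j)" for j
  have shape: "is_star (Suc n + m j - 1) (Q j) \<or> Suc n = 2 \<and> m j = 2 \<and> is_triangle (Q j)"
    if j: "j \<in> I" for j
  proof -
    obtain c L where cL: "finite L" "c \<notin> L" "card L = n + m j - 1" "P j = (\<lambda>l. {c, l}) ` L"
      and c1: "(\<exists>w. \<psi> j = {c, w} \<and> (\<forall>k\<in>I. w \<notin> \<Union> (P k))) \<or> (\<psi> j = L \<and> card L = 2)"
      using \<psi>[OF j] unfolding att_def by blast
    from c1 show ?thesis
    proof
      assume "\<exists>w. \<psi> j = {c, w} \<and> (\<forall>k\<in>I. w \<notin> \<Union> (P k))"
      then obtain w where w: "\<psi> j = {c, w}" "w \<notin> \<Union> (P j)" using j by blast
      have "card (\<psi> j) = 2" using \<psi>[OF j] M(1) E2 by blast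
      hence "w \<noteq> c" using w by auto
      moreover have "w \<notin> L" using w(2) unfolding cL(4) by (auto split: if_splits)
      ultimately have "is_star (Suc n + m j - 1) (Q j)"
        unfolding is_star_def Q_def cL(4) w(1) using cL(1-3) n
        by (intro exI[of _ c] exI[of _ "insert w L"]) auto
      thus ?thesis ..
    next
      assume L: "\<psi> j = L \<and> card L = 2"
      then obtain x y where xy: "L = {x, y}" "x \<noteq> y" by (auto simp: card_2_iff)
      have "Q j = insert {x, y} {{c, x}, {c, y}}" unfolding Q_def cL(4) using L xy(1) by simp
      also have "\<dots> = {{c, x}, {x, y}, {c, y}}" by (rule insert_commute)
      finally have "Q j = {{c, x}, {x, y}, {c, y}}" .
      moreover have "c \<noteq> x" "c \<noteq> y" using cL(2) xy(1) by auto
      ultimately have "is_triangle (Q j)" unfolding is_triangle_def using xy(2) by blast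
      moreover have "Suc n = 2" "m j = 2" using L cL(3) n m[OF j] by auto
      ultimately show ?thesis by blast
    qed
  qed
  have \<psi>V: "\<psi> i \<inter> \<Union> (P j) = {}" if ij: "i \<in> I" "j \<in> I" "i \<noteq> j" for i j
  proof -
    obtain c L where cL: "finite L" "c \<notin> L" "card L = n + m i - 1" "P i = (\<lambda>l. {c, l}) ` L"
      and c1: "(\<exists>w. \<psi> i = {c, w} \<and> (\<forall>k\<in>I. w \<notin> \<Union> (P k))) \<or> (\<psi> i = L \<and> card L = 2)"
      using \<psi>[OF ij(1)] unfolding att_def by blast
    have "card L \<ge> 2" using cL n m[OF ij(1)] by simp
    hence "L \<noteq> {}" by auto
    hence V: "\<Union> (P i) = insert c L" unfolding cL(4) by auto
    have "\<Union> (P i) \<inter> \<Union> (P j) = {}" using same ij by blast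
    thus ?thesis using c1 ij(2) unfolding V by auto
  qed
  have "disjoint_family_on (\<lambda>j. \<Union> (Q j)) I"
    unfolding disjoint_family_on_def
  proof (intro ballI impI)
    fix i j assume ij: "i \<in> I" "j \<in> I" "i \<noteq> j"
    have "\<psi> i \<noteq> \<psi> j" using ij inj_onD[OF inj\<psi>] by blast
    hence "\<psi> i \<inter> \<psi> j = {}" using \<psi>[OF ij(1)] \<psi>[OF ij(2)] M(2) by (simp add: disjoint_def)
    moreover have "\<Union> (P i) \<inter> \<Union> (P j) = {}" using same ij by blast
    ultimately show "\<Union> (Q i) \<inter> \<Union> (Q j) = {}"
      using \<psi>V[OF ij] \<psi>V[of j i] ij unfolding Q_def by auto
  qed
  with shape have "extremal_parts (Suc n) I m Q" unfolding extremal_parts_def by blast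
  moreover have "E = (\<Union>j\<in>I. Q j)"
    using EM range_\<psi> M(1) unfolding Q_def by auto
  ultimately show ?thesis by blast
qed

text \<open>The lower bound and the description of the extremal graphs, on edge sets.\<close>

lemma forces_lower_bound:
  fixes E :: "'a set set" and I :: "'i set"
  assumes "finite I" "\<And>j. j \<in> I \<Longrightarrow> m j \<ge> 2" "n \<ge> 1"
    and "finite E" "\<And>e. e \<in> E \<Longrightarrow> card e = 2" "forces n I m E"
  shows "card E \<ge> (\<Sum>j\<in>I. n + m j - 1) \<and>
    (card E = (\<Sum>j\<in>I. n + m j - 1) \<longrightarrow>
       (\<exists>P. extremal_parts n I m P \<and> E = (\<Union>j\<in>I. P j)))"
  using assms(3-)
proof (induction n arbitrary: E rule: dec_induct)
  case base
  obtain Q where Q: "disjoint_family_on (\<lambda>j. \<Union> (Q j)) I"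
      "\<And>j. j \<in> I \<Longrightarrow> is_star (m j) (Q j)" "\<And>j. j \<in> I \<Longrightarrow> Q j \<subseteq> E"
    using forces_has_forest[OF base(3)] unfolding has_forest_def by auto
  have c: "card (\<Union>j\<in>I. Q j) = (\<Sum>j\<in>I. m j)"
    by (rule card_UN_stars[OF assms(1) Q(1,2)])
  have sub: "(\<Union>j\<in>I. Q j) \<subseteq> E" using Q(3) by blast
  have "(\<Sum>j\<in>I. m j) \<le> card E" using card_mono[OF base(1) sub] c by simp
  moreover have "extremal_parts 1 I m Q" using Q(1,2) unfolding extremal_parts_def by simp
  moreover have "E = (\<Union>j\<in>I. Q j)" if "card E = (\<Sum>j\<in>I. m j)"
    using card_subset_eq[OF base(1) sub] c that by simp
  ultimately show ?case by auto
next
  case (step n)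
  have sum: "(\<Sum>j\<in>I. Suc n + m j - 1) = (\<Sum>j\<in>I. n + m j - 1) + card I"
  proof -
    have "(\<Sum>j\<in>I. Suc n + m j - 1) = (\<Sum>j\<in>I. (n + m j - 1) + 1)"
      using step(1) by (intro sum.cong) auto
    thus ?thesis by (simp only: sum.distrib card_eq_sum)
  qed
  have IH: "card E \<ge> (\<Sum>j\<in>I. n + m j - 1) + card N \<and>
      (card E = (\<Sum>j\<in>I. n + m j - 1) + card N \<longrightarrow>
        (\<exists>P. extremal_parts n I m P \<and> E - N = (\<Union>j\<in>I. P j)))"
    if N: "N \<subseteq> E" "disjoint N" for N
  proof -
    have "card (E - N) \<ge> (\<Sum>j\<in>I. n + m j - 1) \<and>
      (card (E - N) = (\<Sum>j\<in>I. n + m j - 1) \<longrightarrow>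
       (\<exists>P. extremal_parts n I m P \<and> E - N = (\<Union>j\<in>I. P j)))"
      using step(4,5) forces_minus_matching[OF step(6) N step(4)] by (intro step.IH) auto
    moreover have "card E = card (E - N) + card N"
      using N(1) step(4) by (metis card_Diff_subset card_mono finite_subset le_add_diff_inverse2)
    ultimately show ?thesis by auto
  qed
  have "has_forest I m E" by (rule forces_has_forest[OF step(6)]) simp
  then obtain M where M: "M \<subseteq> E" "disjoint M" "card M = card I"
    using has_forest_matching[of I m E] assms(2) by (metis order_trans one_le_numeral)
  have finM: "finite M" using M(1) step(4) finite_subset by blast
  show ?case
  proof (intro conjI impI)
    show "(\<Sum>j\<in>I. Suc n + m j - 1) \<le> card E" using IH[OF M(1,2)] M(3) sum by simp
    assume "card E = (\<Sum>j\<in>I. Suc n + m j - 1)"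
    hence eq: "card E = (\<Sum>j\<in>I. n + m j - 1) + card I" using sum by simp
    show "\<exists>P. extremal_parts (Suc n) I m P \<and> E = (\<Union>j\<in>I. P j)"
    proof (rule extremal_parts_step[OF assms(1) step(1) assms(2) step(5) _ _ M finM])
      fix N :: "'a set set" assume N: "N \<subseteq> E" "disjoint N"
      show "card N \<le> card I" using IH[OF N] eq by simp
      show "\<exists>P. extremal_parts n I m P \<and> E - N = (\<Union>j\<in>I. P j)" if "card N = card I"
        using IH[OF N] eq that by simp
    qed
  qed
qed

section \<open>From edge sets to graphs\<close>

text \<open>The graph without isolated vertices whose edge set is \<open>A\<close>.\<close>

abbreviation edge_graph :: "'a set set \<Rightarrow> 'a graph" where
  "edge_graph A \<equiv> \<lparr>verts = \<Union> A, edges = A\<rparr>"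

lemma graph_iso_refl: "G \<cong>\<^sub>G G"
  unfolding graph_iso_def by (rule exI[of _ id]) auto

lemma simple_edge_graph:
  assumes "finite A" "\<And>e. e \<in> A \<Longrightarrow> card e = 2"
  shows "simple_graph (edge_graph A)"
proof -
  have "finite e" if "e \<in> A" for e using assms(2)[OF that] by (intro card_ge_0_finite) simp
  thus ?thesis using assms unfolding simple_graph_def by auto
qed

lemma simple_graph_edge_graph: "simple_graph F \<Longrightarrow> finite (edges F) \<and> F = edge_graph (edges F)"
  unfolding simple_graph_def by (cases F) (auto dest: finite_UnionD)

lemma graph_iso_star:
  assumes "is_star s A" "s \<ge> 1"
  shows "edge_graph A \<cong>\<^sub>G star s"
proof -
  obtain c L where cL: "finite L" "card L = s" "c \<notin> L" "A = (\<lambda>l. {c, l}) ` L"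
    using assms(1) unfolding is_star_def by blast
  have "L \<noteq> {}" using cL(2) assms(2) by auto
  hence V: "\<Union> A = insert c L" unfolding cL(4) by auto
  obtain g where g: "bij_betw g L {1..s}"
    using cL(1,2) by (metis finite_same_card_bij card_atLeastAtMost diff_Suc_1 finite_atLeastAtMost)
  define f where "f v = (if v = c then 0 else g v)" for v
  have fg: "f v = g v" "f v \<in> {1..s}" if "v \<in> L" for v
    using that cL(3) g unfolding f_def bij_betw_def by auto
  have fc: "f c = 0" by (simp add: f_def)
  have "bij_betw f L {1..s}" using g fg(1) by (simp cong: bij_betw_cong)
  hence bij: "bij_betw f (insert c L) (insert 0 {1..s})"
    using notIn_Un_bij_betw[of c L f "{1..s}"] cL(3) fc by simp
  have ins: "insert 0 {1..s} = {0..s}" by auto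
  have edge_star: "{p, q} \<in> edges (star s) \<longleftrightarrow> p = 0 \<and> q \<in> {1..s} \<or> q = 0 \<and> p \<in> {1..s}" for p q
    unfolding star_def by (auto simp: doubleton_eq_iff)
  have edge_A: "{u, v} \<in> A \<longleftrightarrow> u = c \<and> v \<in> L \<or> v = c \<and> u \<in> L" for u v
    unfolding cL(4) by (auto simp: doubleton_eq_iff)
  have f0: "f v = 0 \<longleftrightarrow> v = c" if "v \<in> insert c L" for v using that fc fg(2) by force
  have f1: "f v \<in> {1..s} \<longleftrightarrow> v \<in> L" if "v \<in> insert c L" for v using that fc fg(2) cL(3) by force
  have "{u, v} \<in> A \<longleftrightarrow> {f u, f v} \<in> edges (star s)" if "u \<in> insert c L" "v \<in> insert c L" for u v
    unfolding edge_A edge_star f0[OF that(1)] f0[OF that(2)] f1[OF that(1)] f1[OF that(2)] ..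
  thus ?thesis unfolding graph_iso_def
    using bij by (intro exI[of _ f]) (simp only: graph.simps V star_def ins, blast)
qed

lemma graph_iso_triangle:
  assumes "is_triangle A"
  shows "edge_graph A \<cong>\<^sub>G complete_graph 3"
proof -
  obtain x y z where xyz: "x \<noteq> y" "y \<noteq> z" "x \<noteq> z" "A = {{x, y}, {y, z}, {x, z}}"
    using assms unfolding is_triangle_def by blast
  have V: "\<Union> A = {x, y, z}" unfolding xyz by auto
  obtain f :: "'a \<Rightarrow> nat" where f: "bij_betw f {x, y, z} {..<3}"
    using finite_same_card_bij[of "{x, y, z}" "{..<3::nat}"] xyz by auto
  have inj: "inj_on f {x, y, z}" using f by (simp add: bij_betw_def)
  have "{u, v} \<in> A \<longleftrightarrow> {f u, f v} \<in> edges (complete_graph 3)"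
    if uv: "u \<in> {x, y, z}" "v \<in> {x, y, z}" for u v
  proof -
    have "{u, v} \<in> A \<longleftrightarrow> u \<noteq> v" using uv xyz by (auto simp: doubleton_eq_iff)
    also have "\<dots> \<longleftrightarrow> f u \<noteq> f v" using inj uv by (auto simp: inj_on_def)
    also have "\<dots> \<longleftrightarrow> {f u, f v} \<in> edges (complete_graph 3)"
    proof -
      have "f u < 3" "f v < 3" using f uv unfolding bij_betw_def by blast+
      thus ?thesis unfolding complete_graph_def by (auto simp: card_insert_if)
    qed
    finally show ?thesis .
  qed
  thus ?thesis unfolding graph_iso_def
    using f by (intro exI[of _ f]) (simp only: graph.simps V complete_graph_def, blast)
qed

lemma edge_disjoint_union_iff:
  "{(i, u), (j, v)} \<in> edges (disjoint_union I G) \<longleftrightarrow> i = j \<and> i \<in> I \<and> {u, v} \<in> edges (G i)"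
proof
  assume "{(i, u), (j, v)} \<in> edges (disjoint_union I G)"
  then obtain k e where k: "k \<in> I" "e \<in> edges (G k)" "{(i, u), (j, v)} = Pair k ` e"
    unfolding disjoint_union_def by auto
  have "i = k" "j = k" using k(3) by (metis Pair_inject image_iff insertCI)+
  moreover have "e = snd ` (Pair k ` e)" by (simp add: image_image)
  hence "e = {u, v}" using k(3) by (metis image_empty image_insert snd_conv)
  ultimately show "i = j \<and> i \<in> I \<and> {u, v} \<in> edges (G i)" using k by blast
next
  assume "i = j \<and> i \<in> I \<and> {u, v} \<in> edges (G i)"
  thus "{(i, u), (j, v)} \<in> edges (disjoint_union I G)"
    unfolding disjoint_union_def by (force intro: image_eqI[of _ _ "{u, v}"])
qed

lemma graph_iso_disjoint_union:
  assumes disj: "disjoint_family_on (\<lambda>j. \<Union> (Q j)) I"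
    and iso: "\<And>j. j \<in> I \<Longrightarrow> edge_graph (Q j) \<cong>\<^sub>G G j"
  shows "edge_graph (\<Union>j\<in>I. Q j) \<cong>\<^sub>G disjoint_union I G"
proof -
  have "\<forall>j\<in>I. \<exists>f. bij_betw f (\<Union> (Q j)) (verts (G j)) \<and>
      (\<forall>u\<in>\<Union> (Q j). \<forall>v\<in>\<Union> (Q j). {u, v} \<in> Q j \<longleftrightarrow> {f u, f v} \<in> edges (G j))"
    using iso unfolding graph_iso_def by simp
  then obtain f where f: "\<And>j. j \<in> I \<Longrightarrow> bij_betw (f j) (\<Union> (Q j)) (verts (G j))"
      "\<And>j u v. j \<in> I \<Longrightarrow> u \<in> \<Union> (Q j) \<Longrightarrow> v \<in> \<Union> (Q j) \<Longrightarrow>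
         {u, v} \<in> Q j \<longleftrightarrow> {f j u, f j v} \<in> edges (G j)"
    by metis
  have same: "i = j" if "i \<in> I" "j \<in> I" "v \<in> \<Union> (Q i)" "v \<in> \<Union> (Q j)" for i j v
    using disj that unfolding disjoint_family_on_def by blast
  define part where "part v = (THE j. j \<in> I \<and> v \<in> \<Union> (Q j))" for v
  have part: "part v = j" if "j \<in> I" "v \<in> \<Union> (Q j)" for j v
    unfolding part_def using that same by (intro the_equality) blast+
  define h where "h v = (part v, f (part v) v)" for v
  have h: "h v = (j, f j v)" if "j \<in> I" "v \<in> \<Union> (Q j)" for j v
    unfolding h_def part[OF that] ..
  have "bij_betw h (\<Union> (\<Union>j\<in>I. Q j)) (SIGMA j:I. verts (G j))"
    unfolding bij_betw_def
  proof
    show "inj_on h (\<Union> (\<Union>j\<in>I. Q j))"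
    proof (rule inj_onI)
      fix u v assume uv: "u \<in> \<Union> (\<Union>j\<in>I. Q j)" "v \<in> \<Union> (\<Union>j\<in>I. Q j)" "h u = h v"
      obtain i j where ij: "i \<in> I" "u \<in> \<Union> (Q i)" "j \<in> I" "v \<in> \<Union> (Q j)" using uv(1,2) by blast
      with uv(3) have "i = j" "f i u = f i v" by (auto simp: h[OF ij(1,2)] h[OF ij(3,4)])
      with f(1)[OF ij(1)] ij show "u = v" unfolding bij_betw_def inj_on_def by blast
    qed
    have im: "f j ` \<Union> (Q j) = verts (G j)" if "j \<in> I" for j
      using f(1)[OF that] by (simp add: bij_betw_def)
    show "h ` \<Union> (\<Union>j\<in>I. Q j) = (SIGMA j:I. verts (G j))"
    proof (intro set_eqI iffI)
      fix p assume "p \<in> h ` \<Union> (\<Union>j\<in>I. Q j)"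
      then obtain v j where v: "p = h v" "j \<in> I" "v \<in> \<Union> (Q j)" by blast
      thus "p \<in> (SIGMA j:I. verts (G j))" using h[OF v(2,3)] im[OF v(2)] by auto
    next
      fix p assume "p \<in> (SIGMA j:I. verts (G j))"
      then obtain j x where x: "p = (j, x)" "j \<in> I" "x \<in> verts (G j)" by blast
      then obtain v where v: "v \<in> \<Union> (Q j)" "x = f j v" using im[OF x(2)] by blast
      with x h[OF x(2) v(1)] have "p = h v" by simp
      thus "p \<in> h ` \<Union> (\<Union>j\<in>I. Q j)" using v(1) x(2) by blast
    qed
  qed
  moreover have "{u, v} \<in> (\<Union>j\<in>I. Q j) \<longleftrightarrow> {h u, h v} \<in> edges (disjoint_union I G)"
    if uv: "u \<in> \<Union> (\<Union>j\<in>I. Q j)" "v \<in> \<Union> (\<Union>j\<in>I. Q j)" for u v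
  proof -
    obtain i j where ij: "i \<in> I" "u \<in> \<Union> (Q i)" "j \<in> I" "v \<in> \<Union> (Q j)" using uv by blast
    have "{u, v} \<in> (\<Union>j\<in>I. Q j) \<longleftrightarrow> i = j \<and> {u, v} \<in> Q i"
    proof
      assume "{u, v} \<in> (\<Union>j\<in>I. Q j)"
      then obtain k where k: "k \<in> I" "{u, v} \<in> Q k" by blast
      hence "k = i" "k = j" using same[OF k(1) ij(1)] same[OF k(1) ij(3)] ij by blast+
      thus "i = j \<and> {u, v} \<in> Q i" using k by blast
    qed (use ij in blast)
    also have "\<dots> \<longleftrightarrow> i = j \<and> {f i u, f i v} \<in> edges (G i)"
      using f(2)[OF ij(1,2), of v] ij by blast
    also have "\<dots> \<longleftrightarrow> {h u, h v} \<in> edges (disjoint_union I G)"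
      unfolding h[OF ij(1,2)] h[OF ij(3,4)] edge_disjoint_union_iff using ij by blast
    finally show ?thesis .
  qed
  ultimately show ?thesis unfolding graph_iso_def
    by (intro exI[of _ h]) (simp add: disjoint_union_def)
qed

lemma graph_iso_inverse:
  assumes "H \<cong>\<^sub>G F"
  obtains g where "inj_on g (verts F)"
    "\<And>p q. p \<in> verts F \<Longrightarrow> q \<in> verts F \<Longrightarrow> {p, q} \<in> edges F \<Longrightarrow> {g p, g q} \<in> edges H"
proof -
  obtain f where f: "bij_betw f (verts H) (verts F)"
      "\<And>u v. u \<in> verts H \<Longrightarrow> v \<in> verts H \<Longrightarrow> {u, v} \<in> edges H \<longleftrightarrow> {f u, f v} \<in> edges F"
    using assms unfolding graph_iso_def by blast
  define g where "g = inv_into (verts H) f"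
  have bij: "bij_betw g (verts F) (verts H)" unfolding g_def by (rule bij_betw_inv_into[OF f(1)])
  show ?thesis
  proof (rule that[of g])
    show "inj_on g (verts F)" using bij by (simp add: bij_betw_def)
    fix p q assume pq: "p \<in> verts F" "q \<in> verts F" "{p, q} \<in> edges F"
    have "g p \<in> verts H" "g q \<in> verts H" using bij pq by (auto simp: bij_betw_def)
    moreover have "f (g p) = p" "f (g q) = q"
      using pq f(1) unfolding g_def by (auto simp: bij_betw_inv_into_right)
    ultimately show "{g p, g q} \<in> edges H" using f(2) pq(3) by metis
  qed
qed

lemma mono_copy_star_degree:
  assumes "mono_copy F c k (star n)" "finite (edges F)"
  obtains v where "n \<le> card {e \<in> edges F. c e = k \<and> v \<in> e}"
proof -
  obtain H where H: "subgraph H F" "H \<cong>\<^sub>G star n" "\<And>e. e \<in> edges H \<Longrightarrow> c e = k"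
    using assms(1) unfolding mono_copy_def by blast
  obtain g where g: "inj_on g (verts (star n))"
    "\<And>p q. p \<in> verts (star n) \<Longrightarrow> q \<in> verts (star n) \<Longrightarrow> {p, q} \<in> edges (star n) \<Longrightarrow>
       {g p, g q} \<in> edges H"
    using graph_iso_inverse[OF H(2)] by blast
  have inj: "inj_on (\<lambda>i. {g 0, g i}) {1..n}"
    using g(1) by (auto simp: inj_on_def star_def doubleton_eq_iff)
  have "{g 0, g i} \<in> edges H" if "i \<in> {1..n}" for i
    using that by (intro g(2)) (auto simp: star_def)
  hence sub: "(\<lambda>i. {g 0, g i}) ` {1..n} \<subseteq> {e \<in> edges F. c e = k \<and> g 0 \<in> e}"
    using H(1,3) unfolding subgraph_def by blast
  have "n = card ((\<lambda>i. {g 0, g i}) ` {1..n})" unfolding card_image[OF inj] by simp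
  also have "\<dots> \<le> card {e \<in> edges F. c e = k \<and> g 0 \<in> e}"
    by (rule card_mono[OF _ sub]) (use assms(2) in simp)
  finally show ?thesis by (rule that)
qed

lemma mono_copy_has_forest:
  assumes "mono_copy F c k (disjoint_union I (\<lambda>j. star (m j)))"
  shows "has_forest I m {e \<in> edges F. c e = k}"
proof -
  let ?D = "disjoint_union I (\<lambda>j. star (m j))"
  obtain H where H: "subgraph H F" "H \<cong>\<^sub>G ?D" "\<And>e. e \<in> edges H \<Longrightarrow> c e = k"
    using assms unfolding mono_copy_def by blast
  obtain g where g: "inj_on g (verts ?D)"
    "\<And>p q. p \<in> verts ?D \<Longrightarrow> q \<in> verts ?D \<Longrightarrow> {p, q} \<in> edges ?D \<Longrightarrow> {g p, g q} \<in> edges H"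
    using graph_iso_inverse[OF H(2)] by blast
  have V: "(j, i) \<in> verts ?D \<longleftrightarrow> j \<in> I \<and> i \<le> m j" for j i
    by (auto simp: disjoint_union_def star_def)
  have inj: "(j, i) = (j', i')" if "g (j, i) = g (j', i')" "j \<in> I" "i \<le> m j" "j' \<in> I" "i' \<le> m j'"
    for j i j' i'
    using that g(1) unfolding inj_on_def by (metis V)
  define L where "L j = (\<lambda>i. g (j, i)) ` {1..m j}" for j
  define Q where "Q j = (\<lambda>l. {g (j, 0), l}) ` L j" for j
  have "is_star (m j) (Q j)" if j: "j \<in> I" for j
  proof -
    have "inj_on (\<lambda>i. g (j, i)) {1..m j}" using inj j by (auto simp: inj_on_def)
    hence "card (L j) = m j" unfolding L_def by (simp add: card_image)
    moreover have "g (j, 0) \<notin> L j" unfolding L_def using inj[of j 0 j] j by fastforce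
    ultimately show ?thesis
      unfolding is_star_def Q_def by (intro exI[of _ "g (j, 0)"] exI[of _ "L j"]) (auto simp: L_def)
  qed
  moreover have "Q j \<subseteq> {e \<in> edges F. c e = k}" if j: "j \<in> I" for j
  proof -
    have "{g (j, 0), g (j, i)} \<in> edges H" if "i \<in> {1..m j}" for i
    proof (rule g(2))
      show "{(j, 0), (j, i)} \<in> edges ?D"
        using that j unfolding edge_disjoint_union_iff by (auto simp: star_def)
    qed (use that j V in auto)
    thus ?thesis using H(1,3) unfolding Q_def L_def subgraph_def by blast
  qed
  moreover have "disjoint_family_on (\<lambda>j. \<Union> (Q j)) I"
  proof -
    have "\<exists>i\<le>m j. v = g (j, i)" if "v \<in> \<Union> (Q j)" for j v
      using that unfolding Q_def L_def by (auto split: if_splits)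
    thus ?thesis unfolding disjoint_family_on_def using inj by blast
  qed
  ultimately show ?thesis unfolding has_forest_def by blast
qed

lemma arrows_imp_forces:
  assumes "arrows F (star n) (disjoint_union I (\<lambda>j. star (m j)))"
    and "finite (edges F)"
  shows "forces n I m (edges F)"
  unfolding forces_def
proof (intro allI impI)
  fix R assume R: "R \<subseteq> edges F" "\<forall>v. card {e \<in> R. v \<in> e} < n"
  define c where "c e = (if e \<in> R then Red else Blue)" for e
  have "\<not> mono_copy F c Red (star n)"
  proof
    assume "mono_copy F c Red (star n)"
    then obtain v where "n \<le> card {e \<in> edges F. c e = Red \<and> v \<in> e}"
      using mono_copy_star_degree assms(2) by blast
    moreover have "{e \<in> edges F. c e = Red \<and> v \<in> e} = {e \<in> R. v \<in> e}"
      using R(1) by (auto simp: c_def)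
    ultimately show False using R(2) by (metis not_le)
  qed
  hence "mono_copy F c Blue (disjoint_union I (\<lambda>j. star (m j)))"
    using assms(1) unfolding arrows_def by blast
  from mono_copy_has_forest[OF this] show "has_forest I m (edges F - R)"
    by (rule back_subst[of "has_forest I m"]) (auto simp: c_def)
qed

section \<open>Optimality of disjoint unions of stars\<close>

text \<open>This is the pigeonhole principle behind \<open>K\<^bsub>1,n+m-1\<^esub> \<rightarrow> (K\<^bsub>1,n\<^esub>, K\<^bsub>1,m\<^esub>)\<close>, where \<open>B\<close> is the
  set of blue edges.\<close>

lemma is_star_split:
  assumes Q: "is_star s Q" and s: "s \<ge> n + m - 1" and n: "n \<ge> 1" and B: "B \<subseteq> Q"
  shows "(\<exists>A\<subseteq>Q - B. is_star n A) \<or> (\<exists>A\<subseteq>B. is_star m A)"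
proof -
  obtain c L where cL: "finite L" "card L = s" "c \<notin> L" "Q = (\<lambda>l. {c, l}) ` L"
    using Q unfolding is_star_def by blast
  have sub: "\<exists>A\<subseteq>X. is_star k A"
    if X: "X = (\<lambda>l. {c, l}) ` L'" "L' \<subseteq> L" "k \<le> card L'" for X L' k
  proof -
    obtain K where "K \<subseteq> L'" "card K = k" "finite K"
      using obtain_subset_with_card_n[OF X(3)] by metis
    thus ?thesis using X(1,2) cL(3) unfolding is_star_def
      by (intro exI[of _ "(\<lambda>l. {c, l}) ` K"]) blast
  qed
  define L1 where "L1 = {l \<in> L. {c, l} \<in> B}"
  have "card L = card L1 + card (L - L1)"
    using cL(1) by (subst card_Un_disjoint[symmetric])
      (auto simp: L1_def intro: arg_cong[of _ _ card])
  hence "n \<le> card (L - L1) \<or> m \<le> card L1" using s cL(2) n by linarith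
  moreover have "B = (\<lambda>l. {c, l}) ` L1" "Q - B = (\<lambda>l. {c, l}) ` (L - L1)"
    using B unfolding cL(4) L1_def by blast+
  moreover have "L1 \<subseteq> L" "L - L1 \<subseteq> L" by (auto simp: L1_def)
  ultimately show ?thesis using sub[of B L1 m] sub[of "Q - B" "L - L1" n] by metis
qed

lemma arrows_union_of_stars:
  assumes fin: "finite I" and n: "n \<ge> 1" and m: "\<And>j. j \<in> I \<Longrightarrow> m j \<ge> 1"
    and disj: "disjoint_family_on (\<lambda>j. \<Union> (Q j)) I"
    and Q: "\<And>j. j \<in> I \<Longrightarrow> is_star (n + m j - 1) (Q j)"
  shows "arrows (edge_graph (\<Union>j\<in>I. Q j)) (star n) (disjoint_union I (\<lambda>j. star (m j)))"
  unfolding arrows_def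
proof (rule allI)
  fix c :: "'b set \<Rightarrow> colour"
  let ?E = "\<Union>j\<in>I. Q j"
  have sub: "subgraph (edge_graph A) (edge_graph ?E)" if "A \<subseteq> ?E" for A
  proof -
    have "finite ?E" using fin is_star_finite[OF Q] by blast
    hence "finite A" using that finite_subset by blast
    moreover have "card e = 2" if "e \<in> A" for e
      using that \<open>A \<subseteq> ?E\<close> card_edge_is_star[OF Q] by blast
    ultimately have "simple_graph (edge_graph A)" by (rule simple_edge_graph)
    thus ?thesis using that unfolding subgraph_def by auto
  qed
  show "mono_copy (edge_graph ?E) c Red (star n) \<or>
        mono_copy (edge_graph ?E) c Blue (disjoint_union I (\<lambda>j. star (m j)))"
  proof (cases "\<exists>j\<in>I. \<exists>A\<subseteq>Q j - {e \<in> Q j. c e = Blue}. is_star n A")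
    case True
    then obtain j A where A: "j \<in> I" "A \<subseteq> Q j - {e \<in> Q j. c e = Blue}" "is_star n A" by blast
    have "c e = Red" if "e \<in> A" for e using that A(2) by (cases "c e") auto
    moreover have "A \<subseteq> ?E" using A(1,2) by blast
    ultimately have "mono_copy (edge_graph ?E) c Red (star n)"
      unfolding mono_copy_def using sub[of A] graph_iso_star[OF A(3) n]
      by (intro exI[of _ "edge_graph A"]) auto
    thus ?thesis ..
  next
    case False
    hence "\<exists>A\<subseteq>{e \<in> Q j. c e = Blue}. is_star (m j) A" if "j \<in> I" for j
      using is_star_split[OF Q[OF that] order_refl n, of "{e \<in> Q j. c e = Blue}"] that by blast
    then obtain A where A: "\<And>j. j \<in> I \<Longrightarrow> A j \<subseteq> {e \<in> Q j. c e = Blue}"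
        "\<And>j. j \<in> I \<Longrightarrow> is_star (m j) (A j)"
      by metis
    have "disjoint_family_on (\<lambda>j. \<Union> (A j)) I"
      using disj A(1) unfolding disjoint_family_on_def by blast
    hence "edge_graph (\<Union>j\<in>I. A j) \<cong>\<^sub>G disjoint_union I (\<lambda>j. star (m j))"
      by (rule graph_iso_disjoint_union) (use graph_iso_star A(2) m in blast)
    moreover have "(\<Union>j\<in>I. A j) \<subseteq> ?E" using A(1) by blast
    moreover have "\<forall>e\<in>(\<Union>j\<in>I. A j). c e = Blue" using A(1) by blast
    ultimately have "mono_copy (edge_graph ?E) c Blue (disjoint_union I (\<lambda>j. star (m j)))"
      unfolding mono_copy_def using sub[of "\<Union>j\<in>I. A j"]
      by (intro exI[of _ "edge_graph (\<Union>j\<in>I. A j)"]) simp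
    thus ?thesis ..
  qed
qed

lemma ex_disjoint_stars:
  fixes I :: "nat set"
  obtains Q :: "nat \<Rightarrow> nat set set"
  where "disjoint_family_on (\<lambda>j. \<Union> (Q j)) I" "\<And>j. is_star (s j) (Q j)"
proof
  \<comment> \<open>The vertex \<open>i\<close> of the \<open>j\<close>-th star is encoded as the pair \<open>(j, i)\<close>, with centre \<open>i = 0\<close>.\<close>
  define Q :: "nat \<Rightarrow> nat set set" where
    "Q j = (\<lambda>l. {prod_encode (j, 0), l}) ` ((\<lambda>i. prod_encode (j, i)) ` {1..s j})" for j
  show "is_star (s j) (Q j)" for j
  proof -
    have "inj_on (\<lambda>i. prod_encode (j, i)) {1..s j}" by (auto simp: inj_on_def prod_encode_eq)
    thus ?thesis unfolding is_star_def Q_def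
      by (intro exI conjI) (auto simp: card_image prod_encode_eq)
  qed
  show "disjoint_family_on (\<lambda>j. \<Union> (Q j)) I"
    by (auto simp: disjoint_family_on_def Q_def prod_encode_eq)
qed

section \<open>The size Ramsey number and the extremal graphs\<close>

theorem theorem2p3:
  fixes n t :: nat and m :: "nat \<Rightarrow> nat"
  assumes "n \<ge> 1" and "t \<ge> 1"
    and "\<And>i j. 1 \<le> i \<Longrightarrow> i \<le> j \<Longrightarrow> j \<le> t \<Longrightarrow> m i \<ge> m j"
    and "m t \<ge> 2"
  shows "size_ramsey (star n) (disjoint_union {1..t} (\<lambda>j. star (m j)))
           = (\<Sum>j=1..t. (n + m j - 1))
       \<and> (\<forall>F :: 'a graph.
            simple_graph F \<longrightarrow>
            arrows F (star n) (disjoint_union {1..t} (\<lambda>j. star (m j))) \<longrightarrow>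
            card (edges F) = (\<Sum>j=1..t. (n + m j - 1)) \<longrightarrow>
            (\<exists>G :: nat \<Rightarrow> nat graph.
               F \<cong>\<^sub>G disjoint_union {1..t} G \<and>
               (\<forall>j\<in>{1..t}. simple_graph (G j) \<and>
                  (G j \<cong>\<^sub>G star (n + m j - 1)
                  \<or> (n = 2 \<and> m j = 2 \<and> G j \<cong>\<^sub>G complete_graph 3)))))"
proof -
  let ?I = "{1..t}" and ?S = "\<Sum>j=1..t. (n + m j - 1)"
  let ?D = "disjoint_union ?I (\<lambda>j. star (m j))"
  have m: "m j \<ge> 2" if "j \<in> ?I" for j using assms(3)[of j t] assms(4) that by auto
  have lower: "card (edges F) \<ge> ?S \<and> (card (edges F) = ?S \<longrightarrow>
      (\<exists>P. extremal_parts n ?I m P \<and> edges F = (\<Union>j\<in>?I. P j)))"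
    if F: "simple_graph F" "arrows F (star n) ?D" for F :: "'b graph"
  proof (rule forces_lower_bound)
    show fin: "finite (edges F)" using simple_graph_edge_graph[OF F(1)] ..
    show "forces n ?I m (edges F)" by (rule arrows_imp_forces[OF F(2) fin])
    show "card e = 2" if "e \<in> edges F" for e using F(1) that unfolding simple_graph_def by blast
  qed (use m assms(1) in auto)
  have "size_ramsey (star n) ?D = ?S"
    unfolding size_ramsey_def
  proof (rule cInf_eq_minimum)
    obtain Q :: "nat \<Rightarrow> nat set set"
      where Q: "disjoint_family_on (\<lambda>j. \<Union> (Q j)) ?I" "\<And>j. is_star (n + m j - 1) (Q j)"
      using ex_disjoint_stars[of ?I "\<lambda>j. n + m j - 1"] by blast
    let ?G = "edge_graph (\<Union>j\<in>?I. Q j)"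
    have "simple_graph ?G"
      by (rule simple_edge_graph) (use Q(2) is_star_finite card_edge_is_star in blast)+
    moreover have "arrows ?G (star n) ?D"
      by (rule arrows_union_of_stars) (use assms(1) m Q in force)+
    moreover have "card (edges ?G) = ?S" using card_UN_stars[OF _ Q(1) Q(2)] by simp
    ultimately show "?S \<in> {card (edges G) | G :: nat graph. simple_graph G \<and> arrows G (star n) ?D}"
      by (metis (mono_tags, lifting) mem_Collect_eq)
  qed (use lower in blast)
  moreover have "\<exists>G :: nat \<Rightarrow> nat graph. F \<cong>\<^sub>G disjoint_union ?I G \<and>
      (\<forall>j\<in>?I. simple_graph (G j) \<and> (G j \<cong>\<^sub>G star (n + m j - 1)
          \<or> (n = 2 \<and> m j = 2 \<and> G j \<cong>\<^sub>G complete_graph 3)))"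
    if F: "simple_graph F" "arrows F (star n) ?D" "card (edges F) = ?S" for F :: "'a graph"
  proof -
    obtain P where P: "extremal_parts n ?I m P" "edges F = (\<Union>j\<in>?I. P j)"
      using lower[OF F(1,2)] F(3) by blast
    define G where "G j = (if is_star (n + m j - 1) (P j) then star (n + m j - 1)
      else complete_graph 3)" for j
    have shape: "is_star (n + m j - 1) (P j) \<or> n = 2 \<and> m j = 2 \<and> is_triangle (P j)"
      if "j \<in> ?I" for j
      using P(1) that unfolding extremal_parts_def by blast
    have pos: "n + m j - 1 \<ge> 1" if "j \<in> ?I" for j using m[OF that] by simp
    have "edge_graph (P j) \<cong>\<^sub>G G j" if "j \<in> ?I" for j
      using shape[OF that] pos[OF that] graph_iso_star graph_iso_triangle unfolding G_def by auto
    hence "edge_graph (\<Union>j\<in>?I. P j) \<cong>\<^sub>G disjoint_union ?I G"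
      using P(1) unfolding extremal_parts_def by (intro graph_iso_disjoint_union) auto
    moreover have "F = edge_graph (\<Union>j\<in>?I. P j)" using simple_graph_edge_graph[OF F(1)] P(2) by simp
    moreover have "simple_graph (G j) \<and> (G j \<cong>\<^sub>G star (n + m j - 1)
          \<or> (n = 2 \<and> m j = 2 \<and> G j \<cong>\<^sub>G complete_graph 3))" if "j \<in> ?I" for j
      using shape[OF that] simple_graph_star[OF pos[OF that]] simple_graph_complete_graph[of 3]
        graph_iso_refl unfolding G_def by auto
    ultimately show ?thesis by metis
  qed
  ultimately show ?thesis by blast
qed

end
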